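(* Let $w$ be an arbitrary word in the alphabet $\{x,D\}$, and let $x^a w D^b$ be its associated Dyck word. For all integers $k \geq 0$, $$S_w(k) = {G_{x^awD^b} \brace k+b}.$$
   Context: Stirling numbers of a word. View $x$ as the operator of multiplication by the variable $x$ and $D$ as differentiation with respect to $x$, acting on infinitely differentiable functions (say on $(0,\infty)$); a word in $\{x,D\}$ is read as the composition of these operators (so $Dx = xD+1$). For every word $w$ with $m$ $x$'s and $n$ $D$'s there is a unique sequence of integers $(S_w(k))_{k\ge 0}$ (only finitely many nonzero) with $$w = x^{m-n}\sum_{k\ge 0} S_w(k)\, x^k D^k .$$ Dyck words. A word in $\{x,D\}$ is a Dyck word if it has the same number of $x$'s as $D$'s and every initial segment (reading left to right) has at least as many $x$'s as $D$'s. A (non-empty) Dyck word is irreducible if it is $xD$ or is of the form $xw'D$ with $w'$ a non-empty Dyck word; otherwise it is reducible, and it can then be written in a unique way as $w_1\cdots w_\ell$ with each $w_i$ irreducible. Words here are non-empty. Associated Dyck word. For a word $w$ in $\{x,D\}$, let $a=a(w)$ be the least non-negative integer such that all initial segments of $x^a w$ have at least as many $x$'s as $D$'s, and let $b=b(w)$ be the unique non-negative integer such that $x^a w D^b$ is a Dyck word. Then $x^awD^b$ is the Dyck word associated with $w$. The graph $G_w$. To each (non-empty) Dyck word $w$ associate an unlabeled graph $G_w$ inductively: (1) if $w=xD$, then $G_w=K_1$ (a single vertex); (2) if $w=xw'D$ is irreducible with $w'$ a non-empty Dyck word, then $G_w$ is obtained from $G_{w'}$ by adding a dominating vertex (a new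 vertex adjacent to all vertices of $G_{w'}$); (3) if $w=w_1\cdots w_\ell$ is reducible with each $w_i$ irreducible, then $G_w$ is the disjoint union of $G_{w_1},\dots,G_{w_\ell}$. Graph Stirling numbers. For a graph $G$ and an integer $k\ge0$, ${G\brace k}$ is the number of partitions of the vertex set of $G$ into $k$ non-empty classes, none of which contains both endvertices of an edge of $G$. *)

theory Defs
  imports "HOL-Analysis.Analysis" "HOL-Library.Sublist" "HOL-Library.Disjoint_Sets"
begin

section \<open>Stirling numbers of a word\<close>

datatype letter = X | D

type_synonym word = "letter list"

text \<open>
  The operators act on functions that are smooth on the half-line of positive reals. Such functions
  are represented by total functions on the reals whose values outside the half-line are irrelevant:
  for positive \<open>x\<close>, the value of \<open>word_op w f\<close> at \<open>x\<close> depends only on \<open>f\<close> near \<open>x\<close>.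
\<close>

definition smooth_pos :: "(real \<Rightarrow> real) \<Rightarrow> bool" where
  "smooth_pos f \<longleftrightarrow> (\<forall>n. \<forall>x>0. (deriv ^^ n) f field_differentiable (at x))"

fun letter_op :: "letter \<Rightarrow> (real \<Rightarrow> real) \<Rightarrow> real \<Rightarrow> real" where
  "letter_op X f = (\<lambda>x. x * f x)"
| "letter_op D f = deriv f"

fun word_op :: "word \<Rightarrow> (real \<Rightarrow> real) \<Rightarrow> real \<Rightarrow> real" where
  "word_op [] f = f"
| "word_op (c # w) f = letter_op c (word_op w f)"

text \<open>
  The expansion of \<open>w\<close> as \<open>x\<^sup>m\<^sup>-\<^sup>n\<close> times the (finite) sum of the \<open>S k x\<^sup>k D\<^sup>k\<close>, where
  \<open>m - n\<close> may be negative.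
\<close>

definition normal_expansion :: "word \<Rightarrow> (nat \<Rightarrow> int) \<Rightarrow> bool" where
  "normal_expansion w S \<longleftrightarrow>
     finite {k. S k \<noteq> 0} \<and>
     (\<forall>f. smooth_pos f \<longrightarrow> (\<forall>x>0.
        word_op w f x =
          x powi (int (count_list w X) - int (count_list w D)) *
          (\<Sum>k | S k \<noteq> 0. of_int (S k) * x ^ k * (deriv ^^ k) f x)))"

definition word_stirling :: "word \<Rightarrow> nat \<Rightarrow> int" where
  "word_stirling w = (THE S. normal_expansion w S)"


section \<open>Dyck words\<close>

definition ballot :: "word \<Rightarrow> bool" where
  "ballot w \<longleftrightarrow> (\<forall>u. prefix u w \<longrightarrow> count_list u D \<le> count_list u X)"

definition dyck :: "word \<Rightarrow> bool" where
  "dyck w \<longleftrightarrow> w \<noteq> [] \<and> count_list w X = count_list w D \<and> ballot w"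

definition irreducible_dyck :: "word \<Rightarrow> bool" where
  "irreducible_dyck w \<longleftrightarrow> w = [X, D] \<or> (\<exists>w'. dyck w' \<and> w = X # w' @ [D])"

definition irreducible_factorization :: "word \<Rightarrow> word list \<Rightarrow> bool" where
  "irreducible_factorization w ws \<longleftrightarrow> (\<forall>v \<in> set ws. irreducible_dyck v) \<and> concat ws = w"

definition irreducible_factors :: "word \<Rightarrow> word list" where
  "irreducible_factors w = (THE ws. irreducible_factorization w ws)"

definition left_defect :: "word \<Rightarrow> nat" where
  "left_defect w = (LEAST a. ballot (replicate a X @ w))"

definition right_defect :: "word \<Rightarrow> nat" where
  "right_defect w = (THE b. dyck (replicate (left_defect w) X @ w @ replicate b D))"

definition associated_dyck :: "word \<Rightarrow> word" where
  "associated_dyck w = replicate (left_defect w) X @ w @ replicate (right_defect w) D"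

text \<open>
  The decomposition into irreducible Dyck words exists and is unique. This is needed below for the
  termination of the recursion that defines the graph of a Dyck word.
\<close>

lemma ballot_append_left: "ballot (u @ v) \<Longrightarrow> ballot u"
  by (auto simp: ballot_def)

lemma dyck_irreducible:
  assumes "irreducible_dyck w"
  shows "dyck w"
  using assms unfolding irreducible_dyck_def
proof (elim disjE exE conjE)
  assume "w = [X, D]"
  then show ?thesis
    by (auto simp: dyck_def ballot_def prefix_Cons)
next
  fix w' assume w': "dyck w'" "w = X # w' @ [D]"
  have "count_list u D \<le> count_list u X" if u: "prefix u w" for u
  proof (cases u)
    case (Cons c u')
    with u w' have c: "c = X" "prefix u' (w' @ [D])"
      by auto
    then consider "u' = w' @ [D]" | "prefix u' w'"
      by (auto simp: prefix_snoc)
    then show ?thesis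
    proof cases
      case 1
      then show ?thesis using w' Cons c by (simp add: dyck_def)
    next
      case 2
      then have "count_list u' D \<le> count_list u' X"
        using w' by (auto simp: dyck_def ballot_def)
      then show ?thesis using Cons c by simp
    qed
  qed simp
  then show ?thesis
    using w' by (auto simp: dyck_def ballot_def)
qed

lemma irreducible_dyck_prefix:
  assumes "irreducible_dyck w" "w = u @ v" "u \<noteq> []" "v \<noteq> []"
  shows "count_list u D < count_list u X"
proof -
  from assms(1) obtain w' where w': "w' = [] \<or> dyck w'" "w = X # w' @ [D]"
    unfolding irreducible_dyck_def by auto
  obtain u' where u: "u = X # u'"
    using assms w' by (cases u) auto
  obtain v' d where v: "v = v' @ [d]"
    using assms(4) by (cases v rule: rev_cases) auto
  have "w' @ [D] = (u' @ v') @ [d]"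
    using assms(2) w'(2) u v by simp
  then have "w' = u' @ v'"
    by blast
  then have "count_list u' D \<le> count_list u' X"
    using w'(1) by (auto simp: dyck_def ballot_def)
  then show ?thesis
    using u by simp
qed

lemma dyck_split:
  assumes "dyck w" "\<not> irreducible_dyck w"
  obtains u v where "w = u @ v" "dyck u" "dyck v"
proof (cases "\<exists>u v. w = u @ v \<and> u \<noteq> [] \<and> v \<noteq> [] \<and> count_list u X = count_list u D")
  case True
  then obtain u v where uv: "w = u @ v" "u \<noteq> []" "v \<noteq> []" "count_list u X = count_list u D"
    by blast
  have "ballot v"
    unfolding ballot_def
  proof (intro allI impI)
    fix p assume "prefix p v"
    then have "prefix (u @ p) w" using uv by simp
    then have "count_list (u @ p) D \<le> count_list (u @ p) X"
      using assms(1) unfolding dyck_def ballot_def by blast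
    then show "count_list p D \<le> count_list p X" using uv by simp
  qed
  moreover have "ballot u"
    using assms(1) uv ballot_append_left by (auto simp: dyck_def)
  ultimately have "dyck u" "dyck v"
    using assms(1) uv by (auto simp: dyck_def)
  then show ?thesis using that uv by blast
next
  case False
  have pos: "count_list u D < count_list u X" if "w = u @ v" "u \<noteq> []" "v \<noteq> []" for u v
  proof -
    have "count_list u D \<le> count_list u X"
      using assms(1) that unfolding dyck_def ballot_def by auto
    moreover have "count_list u X \<noteq> count_list u D"
      using False that by blast
    ultimately show ?thesis by simp
  qed
  obtain c w1 where w1: "w = c # w1"
    using assms(1) by (cases w) (auto simp: dyck_def)
  have "prefix [c] w" using w1 by simp
  then have "count_list [c] D \<le> count_list [c] X"
    using assms(1) unfolding dyck_def ballot_def by blast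
  then have c: "c = X" by (cases c) auto
  have "w1 \<noteq> []" using assms(1) w1 c by (auto simp: dyck_def)
  then obtain w' d where w': "w1 = w' @ [d]"
    by (cases w1 rule: rev_cases) auto
  have "count_list (X # w') D < count_list (X # w') X"
    by (rule pos[of _ "[d]"]) (use w1 w' c in auto)
  then have d: "d = D"
    using assms(1) w1 w' c by (cases d) (auto simp: dyck_def)
  have "ballot w'"
    unfolding ballot_def
  proof (intro allI impI)
    fix p assume "prefix p w'"
    then obtain q where "w' = p @ q" by (auto simp: prefix_def)
    then have "count_list (X # p) D < count_list (X # p) X"
      by (intro pos[of _ "q @ [d]"]) (use w1 w' c in auto)
    then show "count_list p D \<le> count_list p X" by simp
  qed
  then have "w' = [] \<or> dyck w'"
    using assms(1) w1 w' c d by (auto simp: dyck_def)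
  then have "irreducible_dyck w"
    using w1 w' c d by (auto simp: irreducible_dyck_def)
  then show ?thesis using assms(2) by blast
qed

lemma irreducible_factorization_exists:
  assumes "dyck w"
  shows "\<exists>ws. irreducible_factorization w ws"
  using assms
proof (induction "length w" arbitrary: w rule: less_induct)
  case less
  show ?case
  proof (cases "irreducible_dyck w")
    case True
    then show ?thesis
      by (intro exI[of _ "[w]"]) (simp add: irreducible_factorization_def)
  next
    case False
    then obtain u v where uv: "w = u @ v" "dyck u" "dyck v"
      using less.prems dyck_split by blast
    then have "length u < length w" "length v < length w"
      by (auto simp: dyck_def)
    then obtain us vs where
      "irreducible_factorization u us" "irreducible_factorization v vs"
      using less.hyps uv by blast
    then show ?thesis
      using uv by (intro exI[of _ "us @ vs"]) (auto simp: irreducible_factorization_def)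
  qed
qed

lemma irreducible_append_eq:
  assumes "irreducible_dyck u" "irreducible_dyck v" "u @ s = v @ t"
  shows "u = v"
proof -
  have bal: "count_list u X = count_list u D" "count_list v X = count_list v D"
    and ne: "u \<noteq> []" "v \<noteq> []"
    using assms(1,2) dyck_irreducible by (auto simp: dyck_def)
  from assms(3) obtain r where "u = v @ r \<or> v = u @ r"
    by (auto simp: append_eq_append_conv2)
  then show ?thesis
    using irreducible_dyck_prefix[OF assms(1), of v r] irreducible_dyck_prefix[OF assms(2), of u r]
      bal ne by (cases "r = []") auto
qed

lemma irreducible_factorization_unique:
  assumes "irreducible_factorization w us" "irreducible_factorization w vs"
  shows "us = vs"
  using assms
proof (induction us arbitrary: w vs)
  case Nil
  then show ?case
    by (cases vs) (auto simp: irreducible_factorization_def irreducible_dyck_def)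
next
  case (Cons u us)
  from Cons.prems obtain v vs' where vs: "vs = v # vs'"
    by (cases vs) (auto simp: irreducible_factorization_def irreducible_dyck_def)
  have "u = v"
    by (rule irreducible_append_eq[of _ _ "concat us" "concat vs'"])
      (use Cons.prems vs in \<open>auto simp: irreducible_factorization_def\<close>)
  moreover have "us = vs'"
    by (rule Cons.IH[of "concat us"])
      (use Cons.prems vs \<open>u = v\<close> in \<open>auto simp: irreducible_factorization_def\<close>)
  ultimately show ?case using vs by simp
qed

lemma irreducible_factors_eqI:
  "irreducible_factorization w ws \<Longrightarrow> irreducible_factors w = ws"
  unfolding irreducible_factors_def
  by (rule the_equality) (auto intro: irreducible_factorization_unique)

lemma irreducible_factors:
  "dyck w \<Longrightarrow> irreducible_factorization w (irreducible_factors w)"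
  using irreducible_factorization_exists irreducible_factors_eqI by metis

lemma length_irreducible_factor_less:
  assumes "dyck w" "\<not> irreducible_dyck w" "v \<in> set (irreducible_factors w)"
  shows "length v < length w"
proof -
  have fac: "\<forall>v \<in> set (irreducible_factors w). irreducible_dyck v"
    "concat (irreducible_factors w) = w"
    using irreducible_factors[OF assms(1)] by (auto simp: irreducible_factorization_def)
  obtain ps qs where "irreducible_factors w = ps @ v # qs"
    using assms(3) by (auto simp: in_set_conv_decomp)
  then have w: "w = concat ps @ v @ concat qs"
    using fac(2) by simp
  have "v \<noteq> w" using fac(1) assms(2,3) by blast
  then show ?thesis using w by (cases "concat ps = [] \<and> concat qs = []") auto
qed


section \<open>The graph of a Dyck word\<close>

text \<open>
  A graph is a pair of a vertex set and a set of two-element sets of vertices. As a representative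
  of the unlabeled graph of a Dyck word we take a graph whose vertices are lists of natural numbers;
  prefixing a number to all lists of a graph gives a relabeled copy, which keeps the new vertex
  \<open>[]\<close> of \<open>add_dominating\<close> fresh and the components of \<open>disjoint_union\<close> apart.
\<close>

type_synonym 'v graph = "'v set \<times> 'v set set"

abbreviation verts :: "'v graph \<Rightarrow> 'v set" where "verts \<equiv> fst"
abbreviation edges :: "'v graph \<Rightarrow> 'v set set" where "edges \<equiv> snd"

definition single_vertex :: "nat list graph" where
  "single_vertex = ({[]}, {})"

definition relabel :: "nat \<Rightarrow> nat list graph \<Rightarrow> nat list graph" where
  "relabel i G = (Cons i ` verts G, image (Cons i) ` edges G)"

definition add_dominating :: "nat list graph \<Rightarrow> nat list graph" where
  "add_dominating G =
     (let H = relabel 0 G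
      in (insert [] (verts H), edges H \<union> {{[], v} |v. v \<in> verts H}))"

definition disjoint_union :: "nat list graph list \<Rightarrow> nat list graph" where
  "disjoint_union Gs =
     (\<Union>i<length Gs. verts (relabel i (Gs ! i)), \<Union>i<length Gs. edges (relabel i (Gs ! i)))"

text \<open>Words that are not Dyck words get the empty graph as a dummy value.\<close>

function dyck_graph :: "word \<Rightarrow> nat list graph" where
  "dyck_graph w =
     (if w = [X, D] then single_vertex
      else if irreducible_dyck w then add_dominating (dyck_graph (butlast (tl w)))
      else if dyck w then disjoint_union (map dyck_graph (irreducible_factors w))
      else ({}, {}))"
  by auto
termination
proof (relation "Wellfounded.measure length", goal_cases)
  case 1
  show ?case by simp
next
  case (2 w)
  then show ?case by (auto simp: irreducible_dyck_def)
next
  case (3 w v)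
  then show ?case by (simp add: length_irreducible_factor_less)
qed

declare dyck_graph.simps [simp del]


section \<open>Graph Stirling numbers\<close>

definition graph_stirling :: "'v graph \<Rightarrow> nat \<Rightarrow> nat" where
  "graph_stirling G k =
     card {P. partition_on (verts G) P \<and> card P = k \<and> (\<forall>C\<in>P. \<forall>e\<in>edges G. \<not> e \<subseteq> C)}"

end

theory Submission
  imports Defs
begin

text \<open>
  Both sides are coefficients of one and the same polynomial in the basis of falling factorials.

  A word \<open>w\<close> maps the power \<open>x\<^sup>t\<close> to a multiple of \<open>x\<^sup>t\<^sup>+\<^sup>m\<^sup>-\<^sup>n\<close>. Since \<open>x\<^sup>kD\<^sup>k\<close> multiplies
  \<open>x\<^sup>t\<close> by the falling factorial \<open>t(t-1)...(t-k+1)\<close>, the scalar \<open>p\<^sub>w(t)\<close> that appears expands in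
  falling factorials with the coefficients \<open>S\<^sub>w(k)\<close> (\<open>newton_normal_coeff\<close>); these coefficients
  are determined by the values at the natural numbers (\<open>newton_coeffs_unique\<close>).

  For a Dyck word, \<open>p\<^sub>w\<close> is the chromatic polynomial of \<open>G\<^sub>w\<close> (\<open>dyck_graph_colourings\<close>), because
  both obey the same recursion. The first application of \<open>D\<close> in \<open>xwD\<close> turns \<open>x\<^sup>t\<close> into
  \<open>tx\<^sup>t\<^sup>-\<^sup>1\<close>, so \<open>p\<close> becomes \<open>t p\<^sub>w(t-1)\<close>; a dominating vertex takes one of \<open>t\<close> colours and leaves
  \<open>t-1\<close> for the rest of the graph. Concatenation of words of degree zero multiplies the scalars, and
  disjoint union multiplies the numbers of colourings. The chromatic polynomial in turn has
  the graph Stirling numbers as its coefficients in falling factorials: a proper colouring is a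
  partition into independent sets together with an injection of its classes into the colours
  (\<open>card_proper_colourings\<close>).

  Finally, passing from \<open>w\<close> to \<open>x\<^sup>awD\<^sup>b\<close> replaces \<open>p\<^sub>w(t)\<close> by \<open>t(t-1)...(t-b+1) p\<^sub>w(t-b)\<close>, which
  turns each falling factorial of length \<open>k\<close> into the one of length \<open>k+b\<close>. The coefficients are
  thus shifted by \<open>b\<close>.
\<close>


section \<open>Falling factorials and Newton series\<close>

definition falling_fact :: "nat \<Rightarrow> nat \<Rightarrow> nat" where
  "falling_fact q k = prod ((-) q) {0..<k}"

lemma falling_fact_0 [simp]: "falling_fact q 0 = 1"
  by (simp add: falling_fact_def)

lemma falling_fact_Suc: "falling_fact q (Suc k) = falling_fact q k * (q - k)"
  by (simp add: falling_fact_def)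

lemma falling_fact_eq_0_iff [simp]: "falling_fact q k = 0 \<longleftrightarrow> q < k"
  by (auto simp: falling_fact_def)

lemma int_falling_fact_Suc:
  "int (falling_fact q (Suc k)) = (int q - int k) * int (falling_fact q k)"
  by (cases "q < k") (auto simp: falling_fact_Suc of_nat_diff)

lemma falling_fact_add:
  "falling_fact (q + b) (k + b) = falling_fact (q + b) b * falling_fact q k"
  by (induction k) (simp_all add: falling_fact_Suc)

text \<open>
  The value of a Newton series at a natural number \<open>q\<close> is a finite sum over \<open>k \<le> q\<close>, even without
  any bound on the support of the coefficients, and the system of these values is triangular with
  the diagonal entries \<open>q!\<close>.
\<close>

lemma newton_coeffs_unique:
  fixes S T :: "nat \<Rightarrow> int"
  assumes "\<And>q. (\<Sum>k\<le>q. S k * int (falling_fact q k)) = (\<Sum>k\<le>q. T k * int (falling_fact q k))"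
  shows "S = T"
proof
  fix q
  show "S q = T q"
  proof (induction q rule: less_induct)
    case (less q)
    have "(\<Sum>k<q. S k * int (falling_fact q k)) = (\<Sum>k<q. T k * int (falling_fact q k))"
      by (intro sum.cong) (simp_all add: less)
    moreover have "{..q} = insert q {..<q}"
      by auto
    ultimately show ?case
      using assms[of q] by simp
  qed
qed


section \<open>The normal expansion of a word\<close>

abbreviation excess :: "word \<Rightarrow> int" where
  "excess w \<equiv> int (count_list w X) - int (count_list w D)"

text \<open>
  A recursion for the coefficients of the normal expansion. The last equation comes from
  \<open>D x\<^sup>e\<^sup>+\<^sup>k D\<^sup>k = (e + k) x\<^sup>e\<^sup>+\<^sup>k\<^sup>-\<^sup>1 D\<^sup>k + x\<^sup>e\<^sup>+\<^sup>k D\<^sup>k\<^sup>+\<^sup>1\<close>, where \<open>e\<close> is the excess of the word.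
\<close>

fun normal_coeff :: "word \<Rightarrow> nat \<Rightarrow> int" where
  "normal_coeff [] k = (if k = 0 then 1 else 0)"
| "normal_coeff (X # w) k = normal_coeff w k"
| "normal_coeff (D # w) k =
    (excess w + int k) * normal_coeff w k + (if k = 0 then 0 else normal_coeff w (k - 1))"

text \<open>
  The scalar \<open>p\<^sub>w(t)\<close> by which \<open>w\<close> acts on powers: \<open>w x\<^sup>t = p\<^sub>w(t) x\<^sup>t\<^sup>+\<^sup>e\<close>, where \<open>e\<close> is the
  excess of \<open>w\<close>. The argument ranges over the integers, because in a product \<open>uv\<close> the word \<open>u\<close>
  acts on the power that \<open>v\<close> leaves, and its exponent can be negative.
\<close>

fun power_factor :: "word \<Rightarrow> int \<Rightarrow> int" where
  "power_factor [] t = 1"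
| "power_factor (X # w) t = power_factor w t"
| "power_factor (D # w) t = (t + excess w) * power_factor w t"

lemma normal_coeff_eq_0: "length w < k \<Longrightarrow> normal_coeff w k = 0"
proof (induction w arbitrary: k)
  case (Cons c w)
  then show ?case by (cases c) auto
qed simp

text \<open>
  The letter \<open>D\<close> multiplies \<open>p\<^sub>w\<close> by \<open>t + e\<close>. On the falling factorial of length \<open>k\<close> this splits as
  \<open>(e + k) + (t - k)\<close>, and the second summand extends the falling factorial to length \<open>k + 1\<close>:
  these are the two summands in the recursion for the coefficients.
\<close>

lemma newton_normal_coeff:
  "(\<Sum>k\<le>q. normal_coeff w k * int (falling_fact q k)) = power_factor w (int q)"
proof (induction w)
  case Nil
  have "(\<Sum>k\<le>q. normal_coeff [] k * int (falling_fact q k)) = (\<Sum>k\<in>{0}. int (falling_fact q k))"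
    by (rule sum.mono_neutral_cong_right) auto
  then show ?case by simp
next
  case (Cons c w)
  show ?case
  proof (cases c)
    case X
    then show ?thesis using Cons by simp
  next
    case D
    let ?S = "normal_coeff w" and ?F = "\<lambda>k. int (falling_fact q k)"
    \<comment> \<open>The added term with index \<open>q + 1\<close> vanishes, since that falling factorial is zero at \<open>q\<close>.\<close>
    have "(\<Sum>k\<le>q. (if k = 0 then 0 else ?S (k - 1)) * ?F k)
        = (\<Sum>k\<le>Suc q. (if k = 0 then 0 else ?S (k - 1)) * ?F k)"
      by simp
    also have "\<dots> = (\<Sum>k\<le>q. ?S k * ?F (Suc k))"
      by (subst sum.atMost_Suc_shift) simp
    finally have "(\<Sum>k\<le>q. normal_coeff (D # w) k * ?F k)
        = (\<Sum>k\<le>q. (excess w + int k) * ?S k * ?F k) + (\<Sum>k\<le>q. ?S k * ?F (Suc k))"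
      by (simp add: distrib_right sum.distrib)
    also have "\<dots> = (\<Sum>k\<le>q. (int q + excess w) * (?S k * ?F k))"
      unfolding int_falling_fact_Suc
      by (subst sum.distrib[symmetric]) (rule sum.cong, simp_all add: algebra_simps)
    also have "\<dots> = (int q + excess w) * power_factor w (int q)"
      by (simp add: sum_distrib_left[symmetric] Cons)
    finally show ?thesis using D by simp
  qed
qed

lemma smooth_pos_deriv:
  assumes "smooth_pos f" "x > 0"
  shows "((deriv ^^ k) f has_field_derivative (deriv ^^ Suc k) f x) (at x)"
  using assms by (simp add: smooth_pos_def DERIV_deriv_iff_field_differentiable)

text \<open>
  The induction over the word needs the factor \<open>x\<^sup>e\<close> inside the sum, so that the product rule
  applies to each summand separately.
\<close>

lemma word_op_eq_normal_form:
  assumes "smooth_pos f" "x > 0"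
  shows "word_op w f x = (\<Sum>k\<le>length w.
    of_int (normal_coeff w k) * (x powi (excess w + int k) * (deriv ^^ k) f x))"
  using assms(2)
proof (induction w arbitrary: x)
  case Nil
  then show ?case by simp
next
  case (Cons c w)
  show ?case
  proof (cases c)
    case X
    have "x * (of_int s * (x powi (excess w + int k) * y)) =
        of_int s * (x powi (excess (X # w) + int k) * y)" for s y k
      using \<open>x > 0\<close> power_int_add_1'[of x "excess w + int k"] by (simp add: algebra_simps)
    then have "x * word_op w f x = (\<Sum>k\<le>length w.
        of_int (normal_coeff w k) * (x powi (excess (X # w) + int k) * (deriv ^^ k) f x))"
      unfolding Cons.IH[OF \<open>x > 0\<close>] sum_distrib_left by (intro sum.cong refl)
    then show ?thesis
      using X normal_coeff_eq_0[of w "Suc (length w)"] by (simp del: count_list.simps)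
  next
    case D
    let ?S = "\<lambda>k. real_of_int (normal_coeff w k)" and ?e = "excess w"
    let ?f = "\<lambda>k. (deriv ^^ k) f"
    define T where "T k = x powi (?e + int k - 1) * ?f k x" for k
    have "((\<lambda>y. \<Sum>k\<le>length w. ?S k * (y powi (?e + int k) * ?f k y)) has_field_derivative
        (\<Sum>k\<le>length w. ?S k * (of_int (?e + int k) * T k + T (Suc k)))) (at x)"
      unfolding T_def
      by (rule derivative_eq_intros smooth_pos_deriv[OF assms(1)] refl
          | use \<open>x > 0\<close> in \<open>force simp: algebra_simps\<close>)+
    \<comment> \<open>The inductive expansion of \<open>word_op w f\<close> holds only on the open half-line, which is enough
      to know its derivative there.\<close>
    then have "(word_op w f has_field_derivative
        (\<Sum>k\<le>length w. ?S k * (of_int (?e + int k) * T k + T (Suc k)))) (at x)"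
      by (rule has_field_derivative_transform_within_open[of _ _ _ "{0<..}"])
        (use Cons in auto)
    then have "word_op (D # w) f x
        = (\<Sum>k\<le>length w. ?S k * (of_int (?e + int k) * T k + T (Suc k)))"
      by (simp add: DERIV_imp_deriv)
    also have "\<dots> = (\<Sum>k\<le>length w. of_int (?e + int k) * ?S k * T k)
        + (\<Sum>k\<le>length w. ?S k * T (Suc k))"
      by (simp add: distrib_left sum.distrib mult_ac)
    also have "(\<Sum>k\<le>length w. of_int (?e + int k) * ?S k * T k)
        = (\<Sum>k\<le>Suc (length w). of_int (?e + int k) * ?S k * T k)"
      by (simp add: normal_coeff_eq_0)
    also have "(\<Sum>k\<le>length w. ?S k * T (Suc k))
        = (\<Sum>k\<le>Suc (length w). (if k = 0 then 0 else ?S (k - 1)) * T k)"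
      by (subst sum.atMost_Suc_shift) simp
    also have "(\<Sum>k\<le>Suc (length w). of_int (?e + int k) * ?S k * T k) + \<dots>
        = (\<Sum>k\<le>Suc (length w). of_int (normal_coeff (D # w) k) * T k)"
      by (subst sum.distrib[symmetric]) (rule sum.cong, auto simp: algebra_simps)
    finally show ?thesis
      using D by (simp add: T_def algebra_simps)
  qed
qed

lemma normal_expansion_normal_coeff: "normal_expansion w (normal_coeff w)"
proof -
  have sub: "{k. normal_coeff w k \<noteq> 0} \<subseteq> {..length w}"
    using normal_coeff_eq_0 by (force simp: not_less[symmetric])
  have "word_op w f x = x powi excess w *
      (\<Sum>k | normal_coeff w k \<noteq> 0. of_int (normal_coeff w k) * x ^ k * (deriv ^^ k) f x)"
    if "smooth_pos f" "x > 0" for f x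
  proof -
    have "word_op w f x = x powi excess w *
        (\<Sum>k\<le>length w. of_int (normal_coeff w k) * x ^ k * (deriv ^^ k) f x)"
      unfolding word_op_eq_normal_form[OF that] sum_distrib_left
      using that(2) by (intro sum.cong) (simp_all add: power_int_add mult_ac)
    also have "(\<Sum>k\<le>length w. of_int (normal_coeff w k) * x ^ k * (deriv ^^ k) f x)
        = (\<Sum>k | normal_coeff w k \<noteq> 0. of_int (normal_coeff w k) * x ^ k * (deriv ^^ k) f x)"
      by (rule sum.mono_neutral_right) (use sub in auto)
    finally show ?thesis .
  qed
  then show ?thesis
    unfolding normal_expansion_def using finite_subset[OF sub] by blast
qed

lemma higher_deriv_power_real:
  "(deriv ^^ k) (\<lambda>x::real. x ^ q) = (\<lambda>x. real (falling_fact q k) * x ^ (q - k))"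
proof (induction k)
  case (Suc k)
  have "((\<lambda>x::real. real (falling_fact q k) * x ^ (q - k)) has_field_derivative
      real (falling_fact q (Suc k)) * x ^ (q - Suc k)) (at x)" for x
    by (auto intro!: derivative_eq_intros simp: falling_fact_Suc)
  then show ?case
    using Suc by (auto intro!: ext DERIV_imp_deriv)
qed simp

lemma smooth_pos_power: "smooth_pos (\<lambda>x. x ^ q)"
  unfolding smooth_pos_def higher_deriv_power_real
  by (auto intro!: derivative_intros)

text \<open>
  Uniqueness of the normal expansion is obtained by testing with the powers \<open>x\<^sup>q\<close> at the point \<open>1\<close>,
  where all powers of \<open>x\<close> disappear and the Newton series of \<open>S\<close> at \<open>q\<close> remains.
\<close>

lemma normal_expansion_newton:
  assumes "normal_expansion w S"
  shows "real_of_int (\<Sum>k\<le>q. S k * int (falling_fact q k)) = word_op w (\<lambda>x. x ^ q) 1"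
proof -
  have fin: "finite {k. S k \<noteq> 0}"
    using assms by (simp add: normal_expansion_def)
  have "word_op w (\<lambda>x. x ^ q) 1 = (\<Sum>k | S k \<noteq> 0. real_of_int (S k * int (falling_fact q k)))"
    using assms smooth_pos_power[of q]
    by (auto simp: normal_expansion_def higher_deriv_power_real)
  also have "\<dots> = (\<Sum>k\<in>{..q} \<inter> {k. S k \<noteq> 0}. real_of_int (S k * int (falling_fact q k)))"
    by (rule sum.mono_neutral_right) (use fin in auto)
  also have "\<dots> = (\<Sum>k\<le>q. real_of_int (S k * int (falling_fact q k)))"
    by (rule sum.mono_neutral_left) auto
  finally show ?thesis by simp
qed

lemma word_stirling_eq_normal_coeff: "word_stirling w = normal_coeff w"
  unfolding word_stirling_def
proof (rule the_equality)
  show "normal_expansion w (normal_coeff w)"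
    by (rule normal_expansion_normal_coeff)
  fix S assume S: "normal_expansion w S"
  show "S = normal_coeff w"
    by (rule newton_coeffs_unique)
      (metis S normal_expansion_normal_coeff normal_expansion_newton of_int_eq_iff)
qed

lemma power_factor_append:
  "power_factor (u @ v) t = power_factor u (t + excess v) * power_factor v t"
proof (induction u)
  case (Cons c u)
  have "t + excess (u @ v) = t + excess v + excess u"
    by simp
  then show ?case
    using Cons by (cases c) (simp_all only: append_Cons power_factor.simps mult.assoc)
qed simp

lemma power_factor_replicate_X [simp]: "power_factor (replicate a X) t = 1"
  by (induction a) simp_all

lemma count_list_replicate [simp]: "count_list (replicate n c) d = (if c = d then n else 0)"
  by (induction n) auto

lemma power_factor_replicate_D:
  "power_factor (replicate b D) (int q) = int (falling_fact q b)"
  by (induction b) (simp_all add: int_falling_fact_Suc)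


section \<open>Proper colourings\<close>

definition wf_graph :: "'v graph \<Rightarrow> bool" where
  "wf_graph G \<longleftrightarrow> finite (verts G) \<and> (\<forall>e\<in>edges G. e \<noteq> {} \<and> e \<subseteq> verts G)"

text \<open>
  Asking for two vertices of different colours on every edge, instead of fixing the two ends of the
  edge, makes the definition apply to edges that are arbitrary sets of vertices. This matches the
  condition that no class of a partition contains an edge.
\<close>

definition proper_colourings :: "'v graph \<Rightarrow> 'c set \<Rightarrow> ('v \<Rightarrow> 'c) set" where
  "proper_colourings G C = {f \<in> verts G \<rightarrow>\<^sub>E C. \<forall>e\<in>edges G. \<exists>u\<in>e. \<exists>v\<in>e. f u \<noteq> f v}"

definition colour_classes :: "'v set \<Rightarrow> ('v \<Rightarrow> 'c) \<Rightarrow> 'v set set" where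
  "colour_classes V f = (\<lambda>v. {u \<in> V. f u = f v}) ` V"

lemma partition_on_colour_classes: "partition_on V (colour_classes V f)"
  by (rule partition_onI) (auto simp: colour_classes_def disjnt_def)

text \<open>
  A colouring with the given classes is the same as an injection of the classes into the colours;
  the two directions are composition with a choice \<open>rep\<close> of representatives and with the map \<open>cls\<close>
  from a vertex to its class.
\<close>

lemma card_colourings_with_classes:
  assumes fin: "finite V" "finite C" and P: "partition_on V P"
  shows "card {f \<in> V \<rightarrow>\<^sub>E C. colour_classes V f = P} = falling_fact (card C) (card P)"
proof -
  have disj: "K = L" if "K \<in> P" "L \<in> P" "v \<in> K" "v \<in> L" for K L v
    using P that by (auto simp: partition_on_def disjoint_def)
  have sub: "K \<subseteq> V" if "K \<in> P" for K
    using P that by (auto simp: partition_on_def)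
  have "\<exists>K. K \<in> P \<and> v \<in> K" if "v \<in> V" for v
    using P that by (auto simp: partition_on_def)
  then obtain cls where cls: "\<And>v. v \<in> V \<Longrightarrow> cls v \<in> P \<and> v \<in> cls v"
    by metis
  have "\<exists>v. v \<in> K" if "K \<in> P" for K
    using P that by (metis all_not_in_conv partition_onD3)
  then obtain rep where rep: "\<And>K. K \<in> P \<Longrightarrow> rep K \<in> K"
    by metis
  have rep_V: "rep K \<in> V" if "K \<in> P" for K
    using rep sub that by blast
  have cls_eq: "cls v = K" if "K \<in> P" "v \<in> K" for v K
    using disj cls sub that by (metis subsetD)
  have fibre: "{u \<in> V. cls u = cls v} = cls v" if "v \<in> V" for v
    using that cls cls_eq sub by blast
  have cls_image: "cls ` V = P"
  proof
    show "cls ` V \<subseteq> P" using cls by blast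
    show "P \<subseteq> cls ` V" using rep rep_V cls_eq by (metis image_eqI subsetI)
  qed
  have class_rep: "{u \<in> V. f u = f (rep K)} = K" if "K \<in> P" "colour_classes V f = P" for f :: "'a \<Rightarrow> 'b" and K
    using that rep[OF that(1)] by (auto simp: colour_classes_def)
  have "bij_betw (\<lambda>f. restrict (f \<circ> rep) P)
      {f \<in> V \<rightarrow>\<^sub>E C. colour_classes V f = P} {g \<in> P \<rightarrow>\<^sub>E C. inj_on g P}"
  proof (rule bij_betwI[where g = "\<lambda>g. restrict (g \<circ> cls) V"])
    show "(\<lambda>f. restrict (f \<circ> rep) P) \<in> {f \<in> V \<rightarrow>\<^sub>E C. colour_classes V f = P} \<rightarrow>
        {g \<in> P \<rightarrow>\<^sub>E C. inj_on g P}"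
    proof
      fix f assume f: "f \<in> {f \<in> V \<rightarrow>\<^sub>E C. colour_classes V f = P}"
      have "inj_on (f \<circ> rep) P"
        by (rule inj_on_inverseI[where g = "\<lambda>c. {u \<in> V. f u = c}"]) (use f class_rep in simp)
      then show "restrict (f \<circ> rep) P \<in> {g \<in> P \<rightarrow>\<^sub>E C. inj_on g P}"
        using f rep_V by auto
    qed
    show "(\<lambda>g. restrict (g \<circ> cls) V) \<in> {g \<in> P \<rightarrow>\<^sub>E C. inj_on g P} \<rightarrow>
        {f \<in> V \<rightarrow>\<^sub>E C. colour_classes V f = P}"
    proof
      fix g assume g: "g \<in> {g \<in> P \<rightarrow>\<^sub>E C. inj_on g P}"
      have "{u \<in> V. restrict (g \<circ> cls) V u = restrict (g \<circ> cls) V v} = cls v" if v: "v \<in> V" for v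
      proof -
        have "{u \<in> V. restrict (g \<circ> cls) V u = restrict (g \<circ> cls) V v} = {u \<in> V. cls u = cls v}"
          using g cls v by (auto dest: inj_onD)
        then show ?thesis using fibre v by simp
      qed
      then have "colour_classes V (restrict (g \<circ> cls) V) = P"
        using cls_image by (auto simp: colour_classes_def)
      then show "restrict (g \<circ> cls) V \<in> {f \<in> V \<rightarrow>\<^sub>E C. colour_classes V f = P}"
        using g cls by auto
    qed
    show "restrict (restrict (f \<circ> rep) P \<circ> cls) V = f"
      if f: "f \<in> {f \<in> V \<rightarrow>\<^sub>E C. colour_classes V f = P}" for f
    proof (rule ext)
      fix v
      show "restrict (restrict (f \<circ> rep) P \<circ> cls) V v = f v"
      proof (cases "v \<in> V")
        case True
        then have "v \<in> {u \<in> V. f u = f (rep (cls v))}"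
          using class_rep[of "cls v" f] f cls[OF True] by blast
        then show ?thesis using True cls by simp
      next
        case False
        then show ?thesis using f by (auto simp: PiE_iff extensional_def)
      qed
    qed
    show "restrict (restrict (g \<circ> cls) V \<circ> rep) P = g"
      if g: "g \<in> {g \<in> P \<rightarrow>\<^sub>E C. inj_on g P}" for g
      using g rep_V rep cls_eq by (intro ext) (auto simp: PiE_iff extensional_def)
  qed
  then have "card {f \<in> V \<rightarrow>\<^sub>E C. colour_classes V f = P} = card {g \<in> P \<rightarrow>\<^sub>E C. inj_on g P}"
    by (rule bij_betw_same_card)
  also have "\<dots> = falling_fact (card C) (card P)"
    using card_inj_on_subset_funcset[OF finite_elements[OF fin(1) P] fin(2) subset_refl]
    by (simp add: falling_fact_def)
  finally show ?thesis .
qed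

lemma proper_iff_classes:
  assumes "wf_graph G"
  shows "(\<forall>e\<in>edges G. \<exists>u\<in>e. \<exists>v\<in>e. f u \<noteq> f v) \<longleftrightarrow>
    (\<forall>K\<in>colour_classes (verts G) f. \<forall>e\<in>edges G. \<not> e \<subseteq> K)"
proof -
  have "(\<exists>u\<in>e. \<exists>v\<in>e. f u \<noteq> f v) \<longleftrightarrow> (\<forall>K\<in>colour_classes (verts G) f. \<not> e \<subseteq> K)"
    if "e \<in> edges G" for e
  proof -
    have e: "e \<noteq> {}" "e \<subseteq> verts G"
      using assms that by (auto simp: wf_graph_def)
    then obtain v where v: "v \<in> e" by blast
    show ?thesis
    proof
      assume "\<exists>u\<in>e. \<exists>v\<in>e. f u \<noteq> f v"
      then obtain u1 u2 where "u1 \<in> e" "u2 \<in> e" "f u1 \<noteq> f u2"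
        by blast
      moreover have "f u1 = f u2" if "K \<in> colour_classes (verts G) f" "u1 \<in> K" "u2 \<in> K" for K
        using that by (auto simp: colour_classes_def)
      ultimately show "\<forall>K\<in>colour_classes (verts G) f. \<not> e \<subseteq> K"
        by blast
    next
      assume "\<forall>K\<in>colour_classes (verts G) f. \<not> e \<subseteq> K"
      then have "\<not> e \<subseteq> {u \<in> verts G. f u = f v}"
        using e v by (auto simp: colour_classes_def)
      then show "\<exists>u\<in>e. \<exists>v\<in>e. f u \<noteq> f v"
        using e v by blast
    qed
  qed
  then have "(\<forall>e\<in>edges G. \<exists>u\<in>e. \<exists>v\<in>e. f u \<noteq> f v) \<longleftrightarrow>
      (\<forall>e\<in>edges G. \<forall>K\<in>colour_classes (verts G) f. \<not> e \<subseteq> K)"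
    by (rule ball_cong[OF refl])
  also have "\<dots> \<longleftrightarrow> (\<forall>K\<in>colour_classes (verts G) f. \<forall>e\<in>edges G. \<not> e \<subseteq> K)"
    by blast
  finally show ?thesis .
qed

text \<open>
  The chromatic polynomial in the basis of falling factorials, by sorting the colourings according
  to their colour classes.
\<close>

lemma card_proper_colourings:
  assumes G: "wf_graph G" and C: "finite C"
  shows "card (proper_colourings G C) =
    (\<Sum>k\<le>card C. graph_stirling G k * falling_fact (card C) k)"
proof -
  define A where "A = {P. partition_on (verts G) P \<and> (\<forall>K\<in>P. \<forall>e\<in>edges G. \<not> e \<subseteq> K)}"
  have V: "finite (verts G)"
    using G by (simp add: wf_graph_def)
  then have A: "finite A"
    using finitely_many_partition_on[OF V] by (auto simp: A_def intro: finite_subset[rotated])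
  let ?B = "\<lambda>P. {f \<in> verts G \<rightarrow>\<^sub>E C. colour_classes (verts G) f = P}"
  let ?F = "falling_fact (card C)"
  have "proper_colourings G C = (\<Union>P\<in>A. ?B P)"
    unfolding proper_colourings_def proper_iff_classes[OF G] A_def
    using partition_on_colour_classes by auto
  also have "card \<dots> = (\<Sum>P\<in>A. card (?B P))"
    by (rule card_UN_disjoint) (use A finite_PiE[OF V, of "\<lambda>_. C"] C in auto)
  also have "\<dots> = (\<Sum>P\<in>A. ?F (card P))"
    by (rule sum.cong) (auto simp: A_def card_colourings_with_classes[OF V C])
  \<comment> \<open>Partitions with more classes than colours contribute zero; dropping them bounds \<open>k\<close>.\<close>
  also have "\<dots> = (\<Sum>P\<in>{P\<in>A. card P \<le> card C}. ?F (card P))"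
    by (rule sum.mono_neutral_right) (use A in auto)
  also have "\<dots> = (\<Sum>k\<le>card C. \<Sum>P | P \<in> {P\<in>A. card P \<le> card C} \<and> card P = k. ?F (card P))"
    by (rule sum.group[symmetric]) (use A in auto)
  also have "\<dots> = (\<Sum>k\<le>card C. graph_stirling G k * ?F k)"
  proof (rule sum.cong[OF refl])
    fix k assume "k \<in> {..card C}"
    then have "{P. P \<in> {P\<in>A. card P \<le> card C} \<and> card P = k} =
        {P. partition_on (verts G) P \<and> card P = k \<and> (\<forall>K\<in>P. \<forall>e\<in>edges G. \<not> e \<subseteq> K)}"
      by (auto simp: A_def)
    then show "(\<Sum>P | P \<in> {P\<in>A. card P \<le> card C} \<and> card P = k. ?F (card P))
        = graph_stirling G k * ?F k"
      by (simp add: graph_stirling_def)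
  qed
  finally show ?thesis .
qed

lemma card_proper_colourings_cong:
  assumes "wf_graph G" "finite B" "finite C" "card B = card C"
  shows "card (proper_colourings G B) = card (proper_colourings G C)"
  using assms by (simp add: card_proper_colourings)


section \<open>Colourings of the graph of a Dyck word\<close>

lemma wf_graph_single_vertex: "wf_graph single_vertex"
  by (simp add: wf_graph_def single_vertex_def)

lemma wf_graph_add_dominating: "wf_graph G \<Longrightarrow> wf_graph (add_dominating G)"
  by (auto simp: wf_graph_def add_dominating_def relabel_def Let_def)

lemma wf_graph_disjoint_union:
  assumes "\<And>G. G \<in> set Gs \<Longrightarrow> wf_graph G"
  shows "wf_graph (disjoint_union Gs)"
proof -
  have "wf_graph (Gs ! i)" if "i < length Gs" for i
    using assms that by simp
  then show ?thesis
    by (fastforce simp: wf_graph_def disjoint_union_def relabel_def)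
qed

lemma card_proper_colourings_single_vertex:
  "card (proper_colourings single_vertex C) = card C"
  by (simp add: proper_colourings_def single_vertex_def card_funcsetE)

text \<open>
  The colour \<open>c\<close> of the dominating vertex \<open>[]\<close> is chosen first; the rest is a proper colouring of
  \<open>G\<close> that avoids \<open>c\<close>.
\<close>

lemma card_proper_colourings_add_dominating:
  assumes G: "wf_graph G" and C: "finite C"
  shows "card (proper_colourings (add_dominating G) C) =
    (\<Sum>c\<in>C. card (proper_colourings G (C - {c})))"
proof -
  let ?W = "insert [] (Cons 0 ` verts G)"
  have verts: "verts (add_dominating G) = ?W"
    by (simp add: add_dominating_def relabel_def Let_def)
  have edges: "edges (add_dominating G) =
      (\<lambda>e. Cons 0 ` e) ` edges G \<union> (\<lambda>v. {[], 0 # v}) ` verts G"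
    by (auto simp: add_dominating_def relabel_def Let_def)
  have sub: "v \<in> verts G" if "e \<in> edges G" "v \<in> e" for e v
    using G that by (auto simp: wf_graph_def)
  have "bij_betw (\<lambda>f. (f [], \<lambda>v\<in>verts G. f (0 # v)))
      (proper_colourings (add_dominating G) C)
      (Sigma C (\<lambda>c. proper_colourings G (C - {c})))"
  proof (rule bij_betwI[where g = "\<lambda>(c, g). \<lambda>u\<in>?W. if u = [] then c else g (tl u)"])
    show "(\<lambda>f. (f [], \<lambda>v\<in>verts G. f (0 # v))) \<in> proper_colourings (add_dominating G) C \<rightarrow>
        (SIGMA c:C. proper_colourings G (C - {c}))"
    proof
      fix f assume f: "f \<in> proper_colourings (add_dominating G) C"
      then have fC: "f [] \<in> C" "\<And>v. v \<in> verts G \<Longrightarrow> f (0 # v) \<in> C"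
        by (auto simp: proper_colourings_def verts)
      have "f (0 # v) \<noteq> f []" if "v \<in> verts G" for v
      proof -
        have "\<exists>a\<in>{[], 0 # v}. \<exists>b\<in>{[], 0 # v}. f a \<noteq> f b"
          using f that unfolding proper_colourings_def edges by blast
        then show ?thesis by auto
      qed
      moreover have "\<exists>u\<in>e. \<exists>v\<in>e. f (0 # u) \<noteq> f (0 # v)" if "e \<in> edges G" for e
      proof -
        have "\<exists>a\<in>Cons 0 ` e. \<exists>b\<in>Cons 0 ` e. f a \<noteq> f b"
          using f that unfolding proper_colourings_def edges by blast
        then show ?thesis by blast
      qed
      ultimately have "(\<lambda>v\<in>verts G. f (0 # v)) \<in> proper_colourings G (C - {f []})"
        using fC sub unfolding proper_colourings_def by fastforce
      then show "(f [], \<lambda>v\<in>verts G. f (0 # v)) \<in> (SIGMA c:C. proper_colourings G (C - {c}))"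
        using fC by blast
    qed
    show "(\<lambda>(c, g). \<lambda>u\<in>?W. if u = [] then c else g (tl u)) \<in>
        (SIGMA c:C. proper_colourings G (C - {c})) \<rightarrow> proper_colourings (add_dominating G) C"
    proof
      fix p assume "p \<in> (SIGMA c:C. proper_colourings G (C - {c}))"
      then obtain c g where p: "p = (c, g)" "c \<in> C" "g \<in> proper_colourings G (C - {c})"
        by blast
      define f where "f = (\<lambda>u\<in>?W. if u = [] then c else g (tl u))"
      have g: "g v \<in> C" "g v \<noteq> c" if "v \<in> verts G" for v
        using p(3) that by (auto simp: proper_colourings_def)
      have f: "f [] = c" "\<And>v. v \<in> verts G \<Longrightarrow> f (0 # v) = g v"
        by (auto simp: f_def)
      have "\<exists>a\<in>e. \<exists>b\<in>e. f a \<noteq> f b" if "e \<in> edges (add_dominating G)" for e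
        using that unfolding edges
      proof (elim UnE imageE)
        fix e' assume e': "e' \<in> edges G" "e = Cons 0 ` e'"
        then obtain u v where "u \<in> e'" "v \<in> e'" "g u \<noteq> g v"
          using p(3) unfolding proper_colourings_def by blast
        then show ?thesis
          using e' f(2) sub[OF e'(1)] by (intro bexI[of _ "0 # u"] bexI[of _ "0 # v"]) auto
      next
        fix v assume v: "v \<in> verts G" "e = {[], 0 # v}"
        then have "f (0 # v) \<noteq> f []"
          using f g by simp
        then show ?thesis
          using v(2) by blast
      qed
      moreover have "f \<in> ?W \<rightarrow>\<^sub>E C"
        using g p(2) by (auto simp: f_def)
      ultimately show "(case p of (c, g) \<Rightarrow> \<lambda>u\<in>?W. if u = [] then c else g (tl u)) \<in>
          proper_colourings (add_dominating G) C"
        unfolding p(1) prod.case f_def[symmetric] proper_colourings_def verts by blast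
    qed
  next
    fix f assume f: "f \<in> proper_colourings (add_dominating G) C"
    show "(case (f [], \<lambda>v\<in>verts G. f (0 # v)) of (c, g) \<Rightarrow>
        \<lambda>u\<in>?W. if u = [] then c else g (tl u)) = f"
      using f unfolding proper_colourings_def verts by (intro ext) (auto simp: PiE_iff extensional_def)
  next
    fix p assume "p \<in> (SIGMA c:C. proper_colourings G (C - {c}))"
    then show "((case p of (c, g) \<Rightarrow> \<lambda>u\<in>?W. if u = [] then c else g (tl u)) [],
        \<lambda>v\<in>verts G. (case p of (c, g) \<Rightarrow> \<lambda>u\<in>?W. if u = [] then c else g (tl u)) (0 # v)) = p"
      by (auto simp: proper_colourings_def PiE_iff extensional_def intro!: ext)
  qed
  then have "card (proper_colourings (add_dominating G) C) =
      card (Sigma C (\<lambda>c. proper_colourings G (C - {c})))"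
    by (rule bij_betw_same_card)
  also have "\<dots> = (\<Sum>c\<in>C. card (proper_colourings G (C - {c})))"
  proof (rule card_SigmaI[OF C], rule ballI)
    show "finite (proper_colourings G (C - {c}))" for c
      using G C finite_PiE[of "verts G" "\<lambda>_. C - {c}"]
      by (simp add: proper_colourings_def wf_graph_def)
  qed
  finally show ?thesis .
qed

text \<open>
  No edge joins two components, so a proper colouring is a family of independent proper colourings
  of the components.
\<close>

lemma card_proper_colourings_disjoint_union:
  assumes Gs: "\<And>G. G \<in> set Gs \<Longrightarrow> wf_graph G"
  shows "card (proper_colourings (disjoint_union Gs) C) =
    (\<Prod>i<length Gs. card (proper_colourings (Gs ! i) C))"
proof -
  let ?n = "length Gs" and ?V = "\<lambda>i. verts (Gs ! i)"
  let ?W = "\<Union>i<?n. Cons i ` ?V i"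
  have verts: "verts (disjoint_union Gs) = ?W"
    by (simp add: disjoint_union_def relabel_def)
  have edges: "edges (disjoint_union Gs) = (\<Union>i<?n. (\<lambda>e. Cons i ` e) ` edges (Gs ! i))"
    by (simp add: disjoint_union_def relabel_def)
  have sub: "v \<in> ?V i" if "i < ?n" "e \<in> edges (Gs ! i)" "v \<in> e" for i e v
    using Gs[of "Gs ! i"] that by (auto simp: wf_graph_def)
  have "bij_betw (\<lambda>f. \<lambda>i\<in>{..<?n}. \<lambda>v\<in>?V i. f (i # v))
      (proper_colourings (disjoint_union Gs) C)
      (\<Pi>\<^sub>E i\<in>{..<?n}. proper_colourings (Gs ! i) C)"
  proof (rule bij_betwI[where g = "\<lambda>h. \<lambda>u\<in>?W. h (hd u) (tl u)"])
    show "(\<lambda>f. \<lambda>i\<in>{..<?n}. \<lambda>v\<in>?V i. f (i # v)) \<in> proper_colourings (disjoint_union Gs) C \<rightarrow>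
        (\<Pi>\<^sub>E i\<in>{..<?n}. proper_colourings (Gs ! i) C)"
    proof
      fix f assume f: "f \<in> proper_colourings (disjoint_union Gs) C"
      have "(\<lambda>v\<in>?V i. f (i # v)) \<in> proper_colourings (Gs ! i) C" if i: "i < ?n" for i
      proof -
        have "\<exists>u\<in>e. \<exists>v\<in>e. f (i # u) \<noteq> f (i # v)" if "e \<in> edges (Gs ! i)" for e
          using f i that unfolding proper_colourings_def edges by fastforce
        then show ?thesis
          using f i sub[OF i] unfolding proper_colourings_def verts by fastforce
      qed
      then show "(\<lambda>i\<in>{..<?n}. \<lambda>v\<in>?V i. f (i # v)) \<in> (\<Pi>\<^sub>E i\<in>{..<?n}. proper_colourings (Gs ! i) C)"
        by auto
    qed
    show "(\<lambda>h. \<lambda>u\<in>?W. h (hd u) (tl u)) \<in> (\<Pi>\<^sub>E i\<in>{..<?n}. proper_colourings (Gs ! i) C) \<rightarrow>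
        proper_colourings (disjoint_union Gs) C"
    proof
      fix h assume h: "h \<in> (\<Pi>\<^sub>E i\<in>{..<?n}. proper_colourings (Gs ! i) C)"
      have hi: "h i \<in> proper_colourings (Gs ! i) C" if "i < ?n" for i
        using h that by auto
      have "\<exists>u\<in>e. \<exists>v\<in>e. (\<lambda>u\<in>?W. h (hd u) (tl u)) u \<noteq> (\<lambda>u\<in>?W. h (hd u) (tl u)) v"
        if edge: "e \<in> edges (disjoint_union Gs)" for e
      proof -
        obtain i e' where e: "i < ?n" "e' \<in> edges (Gs ! i)" "e = Cons i ` e'"
          using edge unfolding edges by blast
        then obtain u v where "u \<in> e'" "v \<in> e'" "h i u \<noteq> h i v"
          using hi unfolding proper_colourings_def by blast
        moreover from this have "i # u \<in> ?W" "i # v \<in> ?W"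
          using e sub by blast+
        ultimately show ?thesis
          using e by (intro bexI[of _ "i # u"] bexI[of _ "i # v"]) simp_all
      qed
      then show "(\<lambda>u\<in>?W. h (hd u) (tl u)) \<in> proper_colourings (disjoint_union Gs) C"
        using hi unfolding proper_colourings_def verts by fastforce
    qed
  next
    fix f assume "f \<in> proper_colourings (disjoint_union Gs) C"
    then show "(\<lambda>u\<in>?W. (\<lambda>i\<in>{..<?n}. \<lambda>v\<in>?V i. f (i # v)) (hd u) (tl u)) = f"
      unfolding proper_colourings_def verts by (intro ext) (auto simp: PiE_iff extensional_def)
  next
    fix h assume h: "h \<in> (\<Pi>\<^sub>E i\<in>{..<?n}. proper_colourings (Gs ! i) C)"
    show "(\<lambda>i\<in>{..<?n}. \<lambda>v\<in>?V i. (\<lambda>u\<in>?W. h (hd u) (tl u)) (i # v)) = h"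
    proof (rule PiE_ext[OF _ h])
      have hi: "h i \<in> ?V i \<rightarrow>\<^sub>E C" if "i < ?n" for i
        using h that by (auto simp: proper_colourings_def)
      have "(\<lambda>v\<in>?V i. (\<lambda>u\<in>?W. h (hd u) (tl u)) (i # v)) = h i" if "i < ?n" for i
        using hi[OF that] that by (intro ext) (auto simp: PiE_iff extensional_def)
      then show "(\<lambda>i\<in>{..<?n}. \<lambda>v\<in>?V i. (\<lambda>u\<in>?W. h (hd u) (tl u)) (i # v)) i = h i"
        if "i \<in> {..<?n}" for i
        using that by simp
      then show "(\<lambda>i\<in>{..<?n}. \<lambda>v\<in>?V i. (\<lambda>u\<in>?W. h (hd u) (tl u)) (i # v)) \<in>
          (\<Pi>\<^sub>E i\<in>{..<?n}. proper_colourings (Gs ! i) C)"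
        using h by (auto simp: PiE_iff)
    qed
  qed
  then show ?thesis
    by (simp add: bij_betw_same_card card_PiE)
qed

lemma power_factor_concat:
  assumes "\<And>v. v \<in> set ws \<Longrightarrow> dyck v"
  shows "power_factor (concat ws) t = (\<Prod>v\<leftarrow>ws. power_factor v t)"
proof -
  have "power_factor (concat ws) t = (\<Prod>v\<leftarrow>ws. power_factor v t) \<and> excess (concat ws) = 0"
    using assms by (induction ws) (auto simp: power_factor_append dyck_def)
  then show ?thesis ..
qed

text \<open>
  The chromatic polynomial of \<open>G\<^sub>w\<close> is \<open>p\<^sub>w\<close>, by induction along the construction of the graph.
\<close>

lemma dyck_graph_colourings:
  assumes "dyck w"
  shows "wf_graph (dyck_graph w) \<and>
    (\<forall>q. int (card (proper_colourings (dyck_graph w) {..<q})) = power_factor w (int q))"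
  using assms
proof (induction "length w" arbitrary: w rule: less_induct)
  case less
  consider (single) "w = [X, D]"
    | (irreducible) w' where "dyck w'" "w = X # w' @ [D]"
    | (reducible) "\<not> irreducible_dyck w"
    by (auto simp: irreducible_dyck_def)
  then show ?case
  proof cases
    case single
    then have "dyck_graph w = single_vertex"
      by (subst dyck_graph.simps) simp
    then show ?thesis
      using single by (simp add: wf_graph_single_vertex card_proper_colourings_single_vertex)
  next
    case irreducible
    have "irreducible_dyck w" "w \<noteq> [X, D]"
      using irreducible by (auto simp: irreducible_dyck_def dyck_def)
    then have graph: "dyck_graph w = add_dominating (dyck_graph w')"
      using irreducible(2) by (subst dyck_graph.simps) simp
    have IH: "wf_graph (dyck_graph w')"
      "\<And>q. int (card (proper_colourings (dyck_graph w') {..<q})) = power_factor w' (int q)"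
      using less.hyps[of w'] irreducible by auto
    have "int (card (proper_colourings (dyck_graph w) {..<q})) = power_factor w (int q)" for q
    proof -
      have "card (proper_colourings (dyck_graph w') ({..<q} - {c})) =
          card (proper_colourings (dyck_graph w') {..<q - 1})" if "c < q" for c
        by (rule card_proper_colourings_cong) (use IH(1) that in auto)
      then have "card (proper_colourings (dyck_graph w) {..<q}) =
          q * card (proper_colourings (dyck_graph w') {..<q - 1})"
        unfolding graph by (simp add: card_proper_colourings_add_dominating IH(1))
      then have "int (card (proper_colourings (dyck_graph w) {..<q})) =
          int q * power_factor w' (int (q - 1))"
        by (simp add: IH(2))
      \<comment> \<open>For \<open>q = 0\<close> the truncated argument \<open>q - 1\<close> is wrong, but the factor \<open>q\<close> makes both sides
        zero.\<close>
      also have "\<dots> = power_factor w (int q)"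
        by (cases q) (simp_all add: irreducible(2) power_factor_append)
      finally show ?thesis .
    qed
    then show ?thesis
      using wf_graph_add_dominating IH(1) graph by auto
  next
    case reducible
    let ?ws = "irreducible_factors w"
    have fac: "concat ?ws = w" "\<And>v. v \<in> set ?ws \<Longrightarrow> dyck v"
      using irreducible_factors[OF less.prems] dyck_irreducible
      by (auto simp: irreducible_factorization_def)
    have "w \<noteq> [X, D]"
      using reducible by (auto simp: irreducible_dyck_def)
    then have graph: "dyck_graph w = disjoint_union (map dyck_graph ?ws)"
      using reducible less.prems by (simp add: dyck_graph.simps[of w])
    have IH: "wf_graph (dyck_graph v)"
      "\<And>q. int (card (proper_colourings (dyck_graph v) {..<q})) = power_factor v (int q)"
      if "v \<in> set ?ws" for v
      using less.hyps[OF length_irreducible_factor_less[OF less.prems reducible that] fac(2)[OF that]]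
      by auto
    have "int (card (proper_colourings (dyck_graph w) {..<q})) = power_factor w (int q)" for q
    proof -
      have "card (proper_colourings (dyck_graph w) {..<q}) =
          (\<Prod>i<length ?ws. card (proper_colourings (dyck_graph (?ws ! i)) {..<q}))"
        unfolding graph by (subst card_proper_colourings_disjoint_union) (auto simp: IH(1))
      then have "int (card (proper_colourings (dyck_graph w) {..<q})) =
          (\<Prod>i<length ?ws. power_factor (?ws ! i) (int q))"
        by (simp add: IH(2))
      also have "\<dots> = (\<Prod>v\<leftarrow>?ws. power_factor v (int q))"
        by (simp add: prod.list_conv_set_nth lessThan_atLeast0)
      also have "\<dots> = power_factor w (int q)"
        using power_factor_concat[of ?ws] fac by simp
      finally show ?thesis .
    qed
    moreover have "wf_graph (dyck_graph w)"
      unfolding graph by (rule wf_graph_disjoint_union) (auto simp: IH(1))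
    ultimately show ?thesis by blast
  qed
qed


section \<open>The associated Dyck word\<close>

lemma ballot_left_defect: "ballot (replicate (left_defect w) X @ w)"
  unfolding left_defect_def
proof (rule LeastI)
  show "ballot (replicate (length w) X @ w)"
    unfolding ballot_def
  proof (intro allI impI)
    fix u assume "prefix u (replicate (length w) X @ w)"
    then consider "prefix u (replicate (length w) X)"
      | v where "u = replicate (length w) X @ v" "prefix v w"
      by (auto simp: prefix_append)
    then show "count_list u D \<le> count_list u X"
    proof cases
      case 1
      then obtain v where "replicate (length w) X = u @ v"
        by (auto simp: prefix_def)
      then have "D \<notin> set u"
        by (metis Un_iff in_set_replicate letter.distinct(1) set_append)
      then show ?thesis by (simp add: count_list_0_iff)
    next
      case 2
      have "count_list v D \<le> length w"
        using count_le_length[of v D] prefix_length_le[OF 2(2)] by linarith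
      then show ?thesis using 2 by simp
    qed
  qed
qed

lemma dyck_append_replicate_D:
  assumes "ballot v" "v \<noteq> []" "count_list v X = count_list v D + b"
  shows "dyck (v @ replicate b D)"
proof -
  have "count_list u D \<le> count_list u X" if u: "prefix u (v @ replicate b D)" for u
  proof (cases "prefix u v")
    case True
    then show ?thesis using assms(1) by (simp add: ballot_def)
  next
    case False
    then obtain s where s: "u = v @ s" "prefix s (replicate b D)"
      using u by (auto simp: prefix_append)
    have "count_list s D \<le> b"
      using count_le_length[of s D] prefix_length_le[OF s(2)] by simp
    then show ?thesis using s assms(3) by simp
  qed
  then show ?thesis
    using assms by (simp add: dyck_def ballot_def)
qed

lemma dyck_associated_dyck:
  assumes "w \<noteq> []"
  shows "dyck (associated_dyck w)"
proof -
  let ?v = "replicate (left_defect w) X @ w"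
  let ?P = "\<lambda>b. dyck (replicate (left_defect w) X @ w @ replicate b D)"
  have "count_list ?v D \<le> count_list ?v X"
    using ballot_left_defect[of w] unfolding ballot_def by blast
  then have ex: "?P (count_list ?v X - count_list ?v D)"
    using dyck_append_replicate_D[OF ballot_left_defect[of w]] assms by simp
  have "?P (right_defect w)"
    unfolding right_defect_def
  proof (rule theI[of ?P, OF ex])
    show "b = count_list ?v X - count_list ?v D" if "?P b" for b
      using that by (auto simp: dyck_def)
  qed
  then show ?thesis by (simp add: associated_dyck_def)
qed

theorem corollary2p5:
  fixes w :: word and k :: nat
  assumes "w \<noteq> []"
  shows "word_stirling w k =
    int (graph_stirling (dyck_graph (associated_dyck w)) (k + right_defect w))"
proof -
  let ?G = "dyck_graph (associated_dyck w)" and ?b = "right_defect w"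
  \<comment> \<open>The coefficients of \<open>x\<^sup>awD\<^sup>b\<close>: those of \<open>w\<close>, shifted by \<open>b\<close>.\<close>
  define S where "S j = (if j < ?b then 0 else normal_coeff w (j - ?b))" for j
  have "(\<lambda>j. int (graph_stirling ?G j)) = S"
  proof (rule newton_coeffs_unique)
    fix q
    have "(\<Sum>j\<le>q. int (graph_stirling ?G j) * int (falling_fact q j)) =
        int (card (proper_colourings ?G {..<q}))"
      using dyck_graph_colourings[OF dyck_associated_dyck[OF assms]]
      by (simp add: card_proper_colourings)
    also have "\<dots> = power_factor (associated_dyck w) (int q)"
      using dyck_graph_colourings[OF dyck_associated_dyck[OF assms]] by blast
    also have "\<dots> = power_factor w (int q - int ?b) * int (falling_fact q ?b)"
      by (simp add: associated_dyck_def power_factor_append power_factor_replicate_D)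
    also have "\<dots> = (\<Sum>j\<le>q. S j * int (falling_fact q j))"
    proof (cases "q < ?b")
      \<comment> \<open>Here \<open>q - b\<close> is negative and the Newton series of \<open>w\<close> is not available, but the falling
        factorial of length \<open>b\<close> is zero.\<close>
      case True
      then show ?thesis by (simp add: S_def)
    next
      case False
      then obtain r where r: "q = r + ?b"
        by (metis add.commute le_Suc_ex not_less)
      have "(\<Sum>j\<le>q. S j * int (falling_fact q j)) =
          (\<Sum>j\<in>{0 + ?b..r + ?b}. S j * int (falling_fact q j))"
        by (rule sum.mono_neutral_right) (auto simp: S_def r)
      also have "\<dots> = (\<Sum>j\<in>{0..r}. S (j + ?b) * int (falling_fact q (j + ?b)))"
        by (rule sum.shift_bounds_cl_nat_ivl)
      also have "\<dots> = (\<Sum>j\<le>r. normal_coeff w j * int (falling_fact r j)) * int (falling_fact q ?b)"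
        unfolding sum_distrib_right atMost_atLeast0
        by (rule sum.cong) (simp_all add: S_def r falling_fact_add)
      finally show ?thesis
        by (simp add: newton_normal_coeff r)
    qed
    finally show "(\<Sum>j\<le>q. int (graph_stirling ?G j) * int (falling_fact q j)) =
        (\<Sum>j\<le>q. S j * int (falling_fact q j))" .
  qed
  then have "int (graph_stirling ?G (k + ?b)) = S (k + ?b)"
    by metis
  then show ?thesis
    by (simp add: S_def word_stirling_eq_normal_coeff)
qed

end
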